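(* Consider a linear quadratic problem with data $(A,B,H)$ for which quadratic strict $(x,u)$-pre-dissipativity holds, with $(A,B)$ stabilizable, and assume that the antistabilizing solution $P_{\mathrm a}$ of the corresponding DARE exists. Then, for any terminal cost matrix $P^{\mathrm f}=P_{\mathrm a}+E$ with $E$ symmetric, $E\succ0$, the optimal solution of the infinite-horizon LQR problem with terminal cost matrix $P^{\mathrm f}$ is given by the unique stabilizing solution $P_{\mathrm s}$ (with gain $K_{\mathrm s}$) of the DARE, i.e. the optimal value function is $V(x)=x^\top P_{\mathrm s}x$ and the optimal feedback is $u=-K_{\mathrm s}x$. In particular, the origin is an asymptotically stable equilibrium of the optimally controlled system.
   Context: Data: real matrices $A\in\mathbb R^{n_x\times n_x}$, $B\in\mathbb R^{n_x\times n_u}$, and a symmetric (possibly indefinite) matrix $H=\begin{bmatrix}Q&S^\top\\ S&R\end{bmatrix}$. Stage cost: $\ell(x,u)=\begin{bmatrix}x\\ u\end{bmatrix}^\top H\begin{bmatrix}x\\ u\end{bmatrix}$. For symmetric $\Lambda$ the rotated cost matrix is $H_\Lambda=\begin{bmatrix}Q+\Lambda-A^\top\Lambda A & S^\top-A^\top\Lambda B\\ S-B^\top\Lambda A& R-B^\top\Lambda B\end{bmatrix}$. Quadratic strict $(x,u)$-pre-dissipativity holds if there is a symmetric $\Lambda$ with $H_\Lambda\succ0$. Infinite-horizon LQR problem with terminal cost matrix $P^{\mathrm f}$: $V(x_0)=\min_{u_0,u_1,\dots}\lim_{N\to\infty}\sum_{k=0}^{N-1}\ell(x_k,u_k)+x_N^\top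 P^{\mathrm f}x_N$ subject to $x_{k+1}=Ax_k+Bu_k$ (over input sequences for which the limit exists in the extended reals). DARE: $P=Q+A^\top PA-(S^\top+A^\top PB)K$, $K=(R+B^\top PB)^{-1}(S+B^\top PA)$; only symmetric solutions are considered. A solution is stabilizing (denoted $P_{\mathrm s}$, gain $K_{\mathrm s}$; unique if it exists) if all eigenvalues of $A-BK_{\mathrm s}$ lie strictly inside the unit circle, and antistabilizing (denoted $P_{\mathrm a}$, gain $K_{\mathrm a}$) if all eigenvalues of $A-BK_{\mathrm a}$ lie strictly outside the unit circle. *)

theory Defs
  imports "HOL-Analysis.Analysis"
begin

section \<open>Block matrices and definiteness\<close>

definition block_vec :: "real^'n \<Rightarrow> real^'m \<Rightarrow> real^('n + 'm)" where
  "block_vec x u = (\<chi> i. case i of Inl a \<Rightarrow> x $ a | Inr b \<Rightarrow> u $ b)"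

text \<open>\<open>block_mat M11 M12 M21 M22\<close> lists the blocks row by row.\<close>

definition block_mat ::
  "real^'n^'n \<Rightarrow> real^'m^'n \<Rightarrow> real^'n^'m \<Rightarrow> real^'m^'m \<Rightarrow> real^('n + 'm)^('n + 'm)" where
  "block_mat M11 M12 M21 M22 =
     (\<chi> i j. case i of
         Inl a \<Rightarrow> (case j of Inl c \<Rightarrow> M11 $ a $ c | Inr d \<Rightarrow> M12 $ a $ d)
       | Inr b \<Rightarrow> (case j of Inl c \<Rightarrow> M21 $ b $ c | Inr d \<Rightarrow> M22 $ b $ d))"

definition symmetric_mat :: "real^'n^'n \<Rightarrow> bool" where
  "symmetric_mat M \<longleftrightarrow> transpose M = M"

definition pos_def :: "real^'n^'n \<Rightarrow> bool" where
  "pos_def M \<longleftrightarrow> symmetric_mat M \<and> (\<forall>x. x \<noteq> 0 \<longrightarrow> x \<bullet> (M *v x) > 0)"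

section \<open>Eigenvalues of real matrices and stabilizability\<close>

definition complex_eigenvalue :: "real^'n^'n \<Rightarrow> complex \<Rightarrow> bool" where
  "complex_eigenvalue M z \<longleftrightarrow> (\<exists>v. v \<noteq> 0 \<and> map_matrix complex_of_real M *v v = z *s v)"

definition schur_stable :: "real^'n^'n \<Rightarrow> bool" where
  "schur_stable M \<longleftrightarrow> (\<forall>z. complex_eigenvalue M z \<longrightarrow> norm z < 1)"

definition schur_antistable :: "real^'n^'n \<Rightarrow> bool" where
  "schur_antistable M \<longleftrightarrow> (\<forall>z. complex_eigenvalue M z \<longrightarrow> norm z > 1)"

definition stabilizable :: "real^'x^'x \<Rightarrow> real^'u^'x \<Rightarrow> bool" where
  "stabilizable A B \<longleftrightarrow> (\<exists>K. schur_stable (A - B ** K))"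

section \<open>Cost matrices and dissipativity\<close>

definition cost_mat ::
  "real^'x^'x \<Rightarrow> real^'x^'u \<Rightarrow> real^'u^'u \<Rightarrow> real^('x + 'u)^('x + 'u)" where
  "cost_mat Q S R = block_mat Q (transpose S) S R"

definition stage_cost :: "real^('x + 'u)^('x + 'u) \<Rightarrow> real^'x \<Rightarrow> real^'u \<Rightarrow> real" where
  "stage_cost H x u = block_vec x u \<bullet> (H *v block_vec x u)"

definition rotated_cost_mat ::
  "real^'x^'x \<Rightarrow> real^'u^'x \<Rightarrow> real^'x^'x \<Rightarrow> real^'x^'u \<Rightarrow> real^'u^'u \<Rightarrow> real^'x^'x
    \<Rightarrow> real^('x + 'u)^('x + 'u)" where
  "rotated_cost_mat A B Q S R L =
     block_mat (Q + L - transpose A ** L ** A) (transpose S - transpose A ** L ** B)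
               (S - transpose B ** L ** A)     (R - transpose B ** L ** B)"

text \<open>Quadratic strict \<open>(x, u)\<close>-pre-dissipativity.\<close>

definition strictly_pre_dissipative ::
  "real^'x^'x \<Rightarrow> real^'u^'x \<Rightarrow> real^'x^'x \<Rightarrow> real^'x^'u \<Rightarrow> real^'u^'u \<Rightarrow> bool" where
  "strictly_pre_dissipative A B Q S R \<longleftrightarrow>
     (\<exists>L. symmetric_mat L \<and> pos_def (rotated_cost_mat A B Q S R L))"

section \<open>The discrete-time algebraic Riccati equation\<close>

definition dare_gain ::
  "real^'x^'x \<Rightarrow> real^'u^'x \<Rightarrow> real^'x^'u \<Rightarrow> real^'u^'u \<Rightarrow> real^'x^'x \<Rightarrow> real^'x^'u" where
  "dare_gain A B S R P =
     matrix_inv (R + transpose B ** P ** B) ** (S + transpose B ** P ** A)"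

text \<open>Invertibility is required explicitly because \<^const>\<open>matrix_inv\<close> is total.\<close>

definition dare_solution ::
  "real^'x^'x \<Rightarrow> real^'u^'x \<Rightarrow> real^'x^'x \<Rightarrow> real^'x^'u \<Rightarrow> real^'u^'u \<Rightarrow> real^'x^'x \<Rightarrow> bool" where
  "dare_solution A B Q S R P \<longleftrightarrow>
     symmetric_mat P \<and>
     invertible (R + transpose B ** P ** B) \<and>
     P = Q + transpose A ** P ** A
           - (transpose S + transpose A ** P ** B) ** dare_gain A B S R P"

definition stabilizing_solution ::
  "real^'x^'x \<Rightarrow> real^'u^'x \<Rightarrow> real^'x^'x \<Rightarrow> real^'x^'u \<Rightarrow> real^'u^'u \<Rightarrow> real^'x^'x \<Rightarrow> bool" where
  "stabilizing_solution A B Q S R P \<longleftrightarrow>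
     dare_solution A B Q S R P \<and> schur_stable (A - B ** dare_gain A B S R P)"

definition antistabilizing_solution ::
  "real^'x^'x \<Rightarrow> real^'u^'x \<Rightarrow> real^'x^'x \<Rightarrow> real^'x^'u \<Rightarrow> real^'u^'u \<Rightarrow> real^'x^'x \<Rightarrow> bool" where
  "antistabilizing_solution A B Q S R P \<longleftrightarrow>
     dare_solution A B Q S R P \<and> schur_antistable (A - B ** dare_gain A B S R P)"

section \<open>The infinite-horizon problem with terminal cost\<close>

primrec trajectory ::
  "real^'x^'x \<Rightarrow> real^'u^'x \<Rightarrow> real^'x \<Rightarrow> (nat \<Rightarrow> real^'u) \<Rightarrow> nat \<Rightarrow> real^'x" where
  "trajectory A B x0 u 0 = x0"
| "trajectory A B x0 u (Suc k) = A *v trajectory A B x0 u k + B *v u k"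

definition finite_cost ::
  "real^'x^'x \<Rightarrow> real^'u^'x \<Rightarrow> real^('x + 'u)^('x + 'u) \<Rightarrow> real^'x^'x
    \<Rightarrow> real^'x \<Rightarrow> (nat \<Rightarrow> real^'u) \<Rightarrow> nat \<Rightarrow> real" where
  "finite_cost A B H Pf x0 u N =
     (\<Sum>k<N. stage_cost H (trajectory A B x0 u k) (u k))
       + trajectory A B x0 u N \<bullet> (Pf *v trajectory A B x0 u N)"

definition has_cost ::
  "real^'x^'x \<Rightarrow> real^'u^'x \<Rightarrow> real^('x + 'u)^('x + 'u) \<Rightarrow> real^'x^'x
    \<Rightarrow> real^'x \<Rightarrow> (nat \<Rightarrow> real^'u) \<Rightarrow> ereal \<Rightarrow> bool" where
  "has_cost A B H Pf x0 u J \<longleftrightarrow> (\<lambda>N. ereal (finite_cost A B H Pf x0 u N)) \<longlonglongrightarrow> J"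

definition value_function ::
  "real^'x^'x \<Rightarrow> real^'u^'x \<Rightarrow> real^('x + 'u)^('x + 'u) \<Rightarrow> real^'x^'x \<Rightarrow> real^'x \<Rightarrow> ereal" where
  "value_function A B H Pf x0 = Inf {J. \<exists>u. has_cost A B H Pf x0 u J}"

definition optimal_input ::
  "real^'x^'x \<Rightarrow> real^'u^'x \<Rightarrow> real^('x + 'u)^('x + 'u) \<Rightarrow> real^'x^'x
    \<Rightarrow> real^'x \<Rightarrow> (nat \<Rightarrow> real^'u) \<Rightarrow> bool" where
  "optimal_input A B H Pf x0 u \<longleftrightarrow> has_cost A B H Pf x0 u (value_function A B H Pf x0)"

section \<open>Feedback and asymptotic stability\<close>

definition closed_loop :: "real^'x^'x \<Rightarrow> real^'u^'x \<Rightarrow> real^'x^'u \<Rightarrow> real^'x \<Rightarrow> real^'x" where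
  "closed_loop A B K x = A *v x + B *v (- (K *v x))"

definition feedback_input ::
  "real^'x^'x \<Rightarrow> real^'u^'x \<Rightarrow> real^'x^'u \<Rightarrow> real^'x \<Rightarrow> nat \<Rightarrow> real^'u" where
  "feedback_input A B K x0 k = - (K *v ((closed_loop A B K ^^ k) x0))"

definition asymptotically_stable_equilibrium ::
  "('a::real_normed_vector \<Rightarrow> 'a) \<Rightarrow> 'a \<Rightarrow> bool" where
  "asymptotically_stable_equilibrium f p \<longleftrightarrow>
     f p = p \<and>
     (\<forall>e>0. \<exists>d>0. \<forall>x. norm (x - p) < d \<longrightarrow> (\<forall>k. norm ((f ^^ k) x - p) < e)) \<and>
     (\<exists>d>0. \<forall>x. norm (x - p) < d \<longrightarrow> (\<lambda>k. (f ^^ k) x) \<longlonglongrightarrow> p)"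

end

theory Submission
  imports Defs "HOL-Computational_Algebra.Fundamental_Theorem_Algebra"
begin

text \<open>
  For a DARE solution \<open>P\<close> with gain \<open>K\<close> and \<open>M = R + B\<^sup>T P B\<close>, completing the square gives
  \<open>\<Sum>\<^bsub>k<N\<^esub> \<ell>(x\<^sub>k, u\<^sub>k) = x\<^sub>0\<^sup>T P x\<^sub>0 - x\<^sub>N\<^sup>T P x\<^sub>N + \<Sum>\<^bsub>k<N\<^esub> v\<^sub>k\<^sup>T M v\<^sub>k\<close> with
  \<open>v\<^sub>k = u\<^sub>k + K x\<^sub>k\<close>. For \<open>P = P\<^sub>a\<close> the matrix \<open>M\<close> is positive semidefinite, so a finite total cost
  with terminal weight \<open>P\<^sub>a + E\<close> keeps \<open>x\<^sub>N\<^sup>T E x\<^sub>N\<close>, hence \<open>x\<^sub>N\<close>, bounded; strict dissipativity then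
  bounds \<open>\<Sum>\<^sub>k |x\<^sub>k|\<^sup>2\<close>, so \<open>x\<^sub>N\<close> tends to \<open>0\<close>. Consequently the same identity for \<open>P = P\<^sub>s\<close>, where
  \<open>M\<close> is positive definite, shows that the cost is at least \<open>x\<^sub>0\<^sup>T P\<^sub>s x\<^sub>0\<close>, with equality exactly when
  all \<open>v\<^sub>k\<close> vanish.

  The stabilizing solution is a matrix of maximal trace in the compact set of subsolutions
  \<open>P \<ge> - L\<close> of the Bellman inequality: the Riccati map sends this set into itself and increases \<open>P\<close>.
\<close>

section \<open>Powers of Schur stable matrices\<close>

text \<open>This is \<open>p(C) x\<close>, the polynomial evaluated at the matrix, written through
  the orbit of a single vector so that no matrix powers occur.\<close>

definition poly_orbit :: "complex^'n^'n \<Rightarrow> complex poly \<Rightarrow> complex^'n \<Rightarrow> complex^'n" where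
  "poly_orbit C p x = (\<Sum>i\<le>degree p. coeff p i *s ((*v) C ^^ i) x)"

lemma poly_orbit_bound:
  assumes "degree p \<le> n"
  shows "poly_orbit C p x = (\<Sum>i\<le>n. coeff p i *s ((*v) C ^^ i) x)"
  unfolding poly_orbit_def
  by (rule sum.mono_neutral_left) (use assms in \<open>auto simp: coeff_eq_0\<close>)

lemma funpow_matrix_diff:
  fixes C :: "'a::field^'n^'n"
  shows "((*v) C ^^ k) (x - y) = ((*v) C ^^ k) x - ((*v) C ^^ k) y"
  by (induction k) (auto simp: matrix_vector_mult_diff_distrib)

lemma funpow_matrix_scale:
  fixes C :: "'a::field^'n^'n"
  shows "((*v) C ^^ k) (c *s x) = c *s ((*v) C ^^ k) x"
  by (induction k) (auto simp: vector_scalar_commute)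

lemma funpow_apply_commute: "(f ^^ k) (f x) = f ((f ^^ k) x)"
  by (induction k) auto

lemma matrix_vector_mult_sum_scale:
  fixes C :: "'a::field^'n^'m"
  assumes "finite I"
  shows "C *v (\<Sum>i\<in>I. c i *s f i) = (\<Sum>i\<in>I. c i *s (C *v f i))"
  using assms
  by (induction I) (auto simp: matrix_vector_right_distrib vector_scalar_commute)

text \<open>\<open>C\<close> commutes with \<open>q(C)\<close>, so the factor \<open>C - c\<close>
  can act first or last. Acting first, it replaces \<open>x\<close> by a vector that
  \<open>q\<close> annihilates; acting last, it can be cancelled when \<open>c\<close> is not an
  eigenvalue.\<close>

lemma poly_orbit_linear_factor:
  "poly_orbit C ([:-c, 1:] * q) x = poly_orbit C q (C *v x - c *s x)"
  "poly_orbit C ([:-c, 1:] * q) x = C *v poly_orbit C q x - c *s poly_orbit C q x"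
proof -
  let ?n = "degree q" and ?T = "(*v) C"
  have deg: "degree ([:-c, 1:] * q) \<le> Suc ?n"
    using degree_mult_le[of "[:-c, 1:]" q] by simp
  have cf: "coeff ([:-c, 1:] * q) (Suc i) = coeff q i - c * coeff q (Suc i)"
    "coeff ([:-c, 1:] * q) 0 = - c * coeff q 0" for i
    by (auto simp: mult_pCons_left)
  have split: "(\<Sum>i\<le>Suc ?n. coeff q i *s (?T ^^ i) x) = (\<Sum>i\<le>?n. coeff q i *s (?T ^^ i) x)"
    by (simp add: coeff_eq_0)
  have "poly_orbit C ([:-c, 1:] * q) x =
      (\<Sum>i\<le>Suc ?n. coeff ([:-c, 1:] * q) i *s (?T ^^ i) x)"
    by (rule poly_orbit_bound[OF deg])
  also have "\<dots> = (\<Sum>i\<le>?n. coeff q i *s (?T ^^ Suc i) x)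
       - c *s (\<Sum>i\<le>Suc ?n. coeff q i *s (?T ^^ i) x)"
    unfolding sum.atMost_Suc_shift cf
    by (simp add: vec.scale_left_diff_distrib sum_subtractf vec.scale_sum_right
        vec.scale_right_distrib)
  finally have *: "poly_orbit C ([:-c, 1:] * q) x =
      (\<Sum>i\<le>?n. coeff q i *s (?T ^^ Suc i) x) - c *s (\<Sum>i\<le>?n. coeff q i *s (?T ^^ i) x)"
    unfolding split .
  show "poly_orbit C ([:-c, 1:] * q) x = C *v poly_orbit C q x - c *s poly_orbit C q x"
    unfolding * by (simp add: poly_orbit_def matrix_vector_mult_sum_scale)
  show "poly_orbit C ([:-c, 1:] * q) x = poly_orbit C q (C *v x - c *s x)"
    unfolding * unfolding poly_orbit_def
    by (simp add: funpow_matrix_diff funpow_matrix_scale funpow_apply_commute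
        vec.scale_right_diff_distrib sum_subtractf vec.scale_sum_right mult.commute)
qed

text \<open>The first \<open>?n + 1\<close> orbit vectors are too many to be independent over the
  reals, where \<open>?n\<close> is the real dimension; a real linear relation between them supplies
  the coefficients.\<close>

lemma exists_annihilating_poly:
  fixes C :: "complex^'n^'n"
  shows "\<exists>p. p \<noteq> 0 \<and> poly_orbit C p x = 0"
proof -
  let ?n = "DIM(complex^'n)" and ?f = "\<lambda>i. ((*v) C ^^ i) x"
  show ?thesis
  proof (cases "inj_on ?f {..?n}")
    case True
    let ?S = "?f ` {..?n}"
    have "card ?S = Suc ?n" using card_image[OF True] by simp
    then have "dependent ?S"
      by (intro dependent_biggerset) auto
    then obtain u v where u: "(\<Sum>w\<in>?S. u w *\<^sub>R w) = 0" and v: "v \<in> ?S" "u v \<noteq> 0"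
      using real_vector.dependent_finite[of ?S] by auto
    define p where "p = (\<Sum>i\<le>?n. monom (complex_of_real (u (?f i))) i)"
    have cp: "coeff p i = complex_of_real (u (?f i))" if "i \<le> ?n" for i
      using that by (simp add: p_def coeff_sum if_distrib cong: if_cong)
    have deg: "degree p \<le> ?n"
      unfolding p_def by (rule degree_sum_le) (auto intro: order_trans[OF degree_monom_le])
    have "poly_orbit C p x = (\<Sum>i\<le>?n. u (?f i) *\<^sub>R ?f i)"
      unfolding poly_orbit_bound[OF deg]
      by (intro sum.cong refl) (simp add: cp vec_eq_iff, simp add: scaleR_conv_of_real)
    also have "\<dots> = 0" using u by (subst (asm) sum.reindex[OF True]) (simp add: o_def)
    finally have "poly_orbit C p x = 0" .
    moreover from v obtain i where "i \<le> ?n" "u (?f i) \<noteq> 0" by auto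
    then have "p \<noteq> 0" using cp[of i] by auto
    ultimately show ?thesis by blast
  next
    case False
    then obtain i j where ij: "i < j" "?f i = ?f j"
      using linorder_inj_onI'[of "{..?n}" ?f] by blast
    \<comment> \<open>Linear dependence concerns the set of orbit vectors and does not see
      repetitions. A repeated vector gives the relation directly.\<close>
    define p where "p = monom (1::complex) j - monom 1 i"
    have deg: "degree p \<le> j" unfolding p_def
      using ij by (intro degree_diff_le) (auto intro: order_trans[OF degree_monom_le])
    have "coeff p j = 1" using ij by (simp add: p_def)
    then have "p \<noteq> 0" by auto
    moreover have "poly_orbit C p x = (\<Sum>k\<le>j. (if k = j then ?f k else 0) - (if k = i then ?f k else 0))"
      unfolding poly_orbit_bound[OF deg] using ij
      by (intro sum.cong refl) (auto simp: p_def vec_eq_iff)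
    then have "poly_orbit C p x = 0"
      using ij by (simp add: sum_subtractf)
    ultimately show ?thesis by blast
  qed
qed

text \<open>Summing the recurrence bounds each partial sum by \<open>a 0 + suminf b\<close> plus
  \<open>r\<close> times itself, and \<open>r < 1\<close> lets that last term be absorbed on the
  left.\<close>

lemma summable_linear_recurrence:
  fixes a b :: "nat \<Rightarrow> real"
  assumes "summable b" "\<And>k. 0 \<le> a k" "\<And>k. 0 \<le> b k" "0 \<le> r" "r < 1"
    and rec: "\<And>k. a (Suc k) \<le> r * a k + b k"
  shows "summable a"
proof (rule bounded_imp_summable)
  fix n
  let ?s = "\<lambda>n. \<Sum>k\<le>n. a k"
  have "?s n \<le> ?s (Suc n)" using assms(2) by simp
  also have "?s (Suc n) = a 0 + (\<Sum>k\<le>n. a (Suc k))" by (rule sum.atMost_Suc_shift)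
  also have "\<dots> \<le> a 0 + (\<Sum>k\<le>n. r * a k + b k)" by (intro add_left_mono sum_mono rec)
  also have "\<dots> = a 0 + r * ?s n + (\<Sum>k\<le>n. b k)" by (simp add: sum.distrib sum_distrib_left)
  also have "(\<Sum>k\<le>n. b k) \<le> suminf b" using assms by (intro sum_le_suminf) auto
  finally have "(1 - r) * ?s n \<le> a 0 + suminf b" by (simp add: algebra_simps)
  then show "?s n \<le> (a 0 + suminf b) / (1 - r)"
    using assms by (simp add: pos_le_divide_eq mult.commute)
qed (use assms in auto)

lemma norm_vector_scalar_mult: "norm (c *s x) = norm c * norm (x :: complex^'n)"
  unfolding norm_vec_def by (simp add: norm_mult L2_set_right_distrib)

text \<open>
  Factors \<open>C - c\<close> with \<open>c\<close> not an eigenvalue are injective and can be cancelled from the annihilating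
  polynomial, so only factors with \<open>|c| < 1\<close> remain to be peeled off.
\<close>

lemma summable_norm_of_annihilated:
  fixes C :: "complex^'n^'n"
  assumes eig: "\<And>c v. v \<noteq> 0 \<Longrightarrow> C *v v = c *s v \<Longrightarrow> norm c < 1"
    and "p \<noteq> 0" "poly_orbit C p x = 0"
  shows "summable (\<lambda>k. norm (((*v) C ^^ k) x))"
  using assms(2,3)
proof (induction "degree p" arbitrary: p x)
  case 0
  then obtain a where "p = [:a:]" "a \<noteq> 0"
    by (metis degree_eq_zeroE pCons_0_0)
  with 0 have "x = 0" by (auto simp: poly_orbit_def vec_eq_iff)
  moreover have "((*v) C ^^ k) 0 = 0" for k by (induction k) auto
  ultimately show ?case by simp
next
  case (Suc d)
  obtain c where "poly p c = 0"
    using fundamental_theorem_of_algebra[of p] Suc by (metis constant_degree nat.distinct(1))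
  then obtain q where p: "p = [:-c, 1:] * q" by (auto simp: poly_eq_0_iff_dvd)
  with Suc have q: "q \<noteq> 0" by auto
  then have dq: "d = degree q"
    using Suc(2) p degree_mult_eq[of "[:-c, 1:]" q] by simp
  show ?case
  proof (cases "\<exists>v. v \<noteq> 0 \<and> C *v v = c *s v")
    case True
    then have c: "norm c < 1" using eig by blast
    \<comment> \<open>\<open>q\<close>, of smaller degree, annihilates \<open>?y\<close>; the orbit
      of \<open>?y\<close> is then the summable forcing term of a recurrence with ratio
      \<open>norm c < 1\<close>.\<close>
    let ?y = "C *v x - c *s x"
    have sy: "summable (\<lambda>k. norm (((*v) C ^^ k) ?y))"
      using Suc(4) unfolding p poly_orbit_linear_factor(1) by (rule Suc(1)[OF dq q])
    have rec: "norm (((*v) C ^^ Suc k) x) \<le>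
        norm c * norm (((*v) C ^^ k) x) + norm (((*v) C ^^ k) ?y)" for k
    proof -
      have "((*v) C ^^ Suc k) x = c *s ((*v) C ^^ k) x + ((*v) C ^^ k) ?y"
        by (simp add: funpow_matrix_diff funpow_matrix_scale funpow_apply_commute)
      then show ?thesis
        by (metis norm_triangle_ineq norm_vector_scalar_mult)
    qed
    show ?thesis
      by (rule summable_linear_recurrence[OF sy _ _ _ c rec]) auto
  next
    case False
    have "C *v poly_orbit C q x = c *s poly_orbit C q x"
      using Suc(4) unfolding p poly_orbit_linear_factor(2) by simp
    then have "poly_orbit C q x = 0" using False by blast
    then show ?thesis by (rule Suc(1)[OF dq q])
  qed
qed

section \<open>Transfer between real orbits and complex eigenvectors\<close>

definition complexify :: "real^'n \<Rightarrow> complex^'n" where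
  "complexify x = (\<chi> i. complex_of_real (x $ i))"

lemma complexify_eq_0_iff [simp]: "complexify x = 0 \<longleftrightarrow> x = 0"
  by (auto simp: complexify_def vec_eq_iff)

lemma norm_complexify: "norm (complexify x) = norm x"
  unfolding norm_vec_def complexify_def by simp

lemma complexify_matrix_vector_mult:
  "map_matrix complex_of_real M *v complexify x = complexify (M *v x)"
  by (auto simp: complexify_def vec_eq_iff matrix_vector_mult_def map_matrix_def)

lemma complexify_funpow:
  fixes M :: "real^'n^'n"
  shows "((*v) (map_matrix complex_of_real M) ^^ k) (complexify x) = complexify (((*v) M ^^ k) x)"
  by (induction k) (auto simp: complexify_matrix_vector_mult)

text \<open>Summability, and not only convergence to 0, is what later bounds the total cost of a
  stabilizing feedback.\<close>

lemma schur_stable_summable_norm: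
  assumes "schur_stable M"
  shows "summable (\<lambda>k. norm (((*v) M ^^ k) x))"
proof -
  let ?C = "map_matrix complex_of_real M"
  obtain p where "p \<noteq> 0" "poly_orbit ?C p (complexify x) = 0"
    using exists_annihilating_poly by blast
  then have "summable (\<lambda>k. norm (((*v) ?C ^^ k) (complexify x)))"
    using assms by (intro summable_norm_of_annihilated)
      (auto simp: schur_stable_def complex_eigenvalue_def)
  then show ?thesis by (simp add: complexify_funpow norm_complexify)
qed

lemma schur_stable_tendsto_0:
  assumes "schur_stable M"
  shows "(\<lambda>k. ((*v) M ^^ k) x) \<longlonglongrightarrow> 0"
  by (rule tendsto_norm_zero_cancel[OF summable_LIMSEQ_zero[OF schur_stable_summable_norm[OF assms]]])

text \<open>An eigenvector is \<open>a + i b\<close> with real \<open>a\<close> and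
  \<open>b\<close>. Its orbit has norm \<open>norm z ^ k * norm v\<close> and is dominated by the
  real orbits of \<open>a\<close> and \<open>b\<close>, so some power of \<open>norm z\<close> falls
  below 1.\<close>

lemma schur_stableI_tendsto_0:
  assumes "\<And>x. (\<lambda>k. ((*v) M ^^ k) x) \<longlonglongrightarrow> 0"
  shows "schur_stable M"
  unfolding schur_stable_def
proof (intro allI impI)
  fix z assume "complex_eigenvalue M z"
  then obtain v where v: "v \<noteq> 0" and Cv: "map_matrix complex_of_real M *v v = z *s v"
    by (auto simp: complex_eigenvalue_def)
  let ?C = "map_matrix complex_of_real M"
  define a b where "a = (\<chi> i. Re (v $ i))" and "b = (\<chi> i. Im (v $ i))"
  have vab: "v = complexify a - (-\<i>) *s complexify b"
    by (auto simp: vec_eq_iff complexify_def a_def b_def complex_eq_iff)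
  have "((*v) ?C ^^ k) v = z ^ k *s v" for k
    by (induction k) (auto simp: vector_scalar_commute Cv mult.commute)
  then have "norm z ^ k * norm v = norm (((*v) ?C ^^ k) v)" for k
    by (simp add: norm_vector_scalar_mult norm_power)
  also have "norm (((*v) ?C ^^ k) v) \<le> norm (((*v) M ^^ k) a) + norm (((*v) M ^^ k) b)" for k
    unfolding vab funpow_matrix_diff funpow_matrix_scale complexify_funpow
    by (rule order_trans[OF norm_triangle_ineq4]) (simp add: norm_vector_scalar_mult norm_complexify)
  finally have le: "norm z ^ k * norm v \<le> norm (((*v) M ^^ k) a) + norm (((*v) M ^^ k) b)" for k .
  have "(\<lambda>k. norm (((*v) M ^^ k) a) + norm (((*v) M ^^ k) b)) \<longlonglongrightarrow> 0"
    using tendsto_add[OF tendsto_norm[OF assms[of a]] tendsto_norm[OF assms[of b]]] by simp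
  then have "\<forall>\<^sub>F k in sequentially. norm (((*v) M ^^ k) a) + norm (((*v) M ^^ k) b) < norm v"
    using v by (intro order_tendstoD) auto
  then obtain k where "norm (((*v) M ^^ k) a) + norm (((*v) M ^^ k) b) < norm v"
    by (auto simp: eventually_sequentially)
  with le[of k] have "norm z ^ k * norm v < 1 * norm v" by linarith
  then have "norm z ^ k < 1" using v by (simp only: mult_less_cancel_right) auto
  then show "norm z < 1" using one_le_power[of "norm z" k] by fastforce
qed

text \<open>Each orbit of a basis vector converges and hence is bounded; linearity combines these
  finitely many bounds into one that is uniform in \<open>k\<close> and \<open>x\<close>.\<close>

lemma schur_stable_norm_bound:
  assumes "schur_stable M"
  obtains c where "c > 0" "\<And>k x. norm (((*v) M ^^ k) x) \<le> c * norm x"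
proof -
  have "\<exists>b. \<forall>k. norm (((*v) M ^^ k) (axis i 1)) \<le> b" for i
    using convergent_imp_Bseq[OF convergentI[OF schur_stable_tendsto_0[OF assms, of "axis i 1"]]]
    by (auto simp: Bseq_def)
  then obtain b where b: "\<And>i k. norm (((*v) M ^^ k) (axis i 1)) \<le> b i" by metis
  have b0: "0 \<le> b i" for i using b[of 0 i] norm_ge_zero order_trans by blast
  \<comment> \<open>The summand 1 only makes the constant strictly positive.\<close>
  have "norm (((*v) M ^^ k) x) \<le> (sum b UNIV + 1) * norm x" for k x
  proof -
    have lin: "linear ((*v) M ^^ k)"
      by (induction k) (auto simp: o_def id_def intro: linear_compose[unfolded o_def] linear_id[unfolded id_def])
    have "((*v) M ^^ k) x = ((*v) M ^^ k) (\<Sum>i\<in>UNIV. x $ i *\<^sub>R axis i 1)"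
      using basis_expansion[of x] by (simp add: scalar_mult_eq_scaleR)
    also have "\<dots> = (\<Sum>i\<in>UNIV. x $ i *\<^sub>R ((*v) M ^^ k) (axis i 1))"
      by (simp add: linear_sum[OF lin] linear_scale[OF lin])
    also have "norm \<dots> \<le> (\<Sum>i\<in>UNIV. norm x * b i)"
      by (intro sum_norm_le) (simp add: mult_mono b b0 component_le_norm_cart)
    also have "\<dots> \<le> (sum b UNIV + 1) * norm x"
      by (simp add: sum_distrib_left[symmetric] algebra_simps)
    finally show ?thesis .
  qed
  moreover have "sum b UNIV + 1 > 0" using b0 by (simp add: sum_nonneg add_nonneg_pos)
  ultimately show ?thesis using that by blast
qed

text \<open>0 is not an eigenvalue, so \<open>M\<close> is invertible, and the eigenvalues of the
  inverse are the reciprocals of those of \<open>M\<close>.\<close>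

lemma schur_antistable_inverse:
  fixes M :: "real^'n^'n"
  assumes "schur_antistable M"
  obtains N where "M ** N = mat 1" "schur_stable N"
proof -
  have "x = 0" if "M *v x = 0" for x
  proof (rule ccontr)
    assume "x \<noteq> 0"
    then have "complex_eigenvalue M 0"
      unfolding complex_eigenvalue_def using that
      by (intro exI[of _ "complexify x"]) (auto simp: complexify_matrix_vector_mult)
    then show False using assms by (auto simp: schur_antistable_def)
  qed
  then obtain N where N: "N ** M = mat 1"
    using matrix_left_invertible_ker[of M] by blast
  then have N': "M ** N = mat 1" by (simp add: matrix_left_right_inverse)
  have "schur_stable N" unfolding schur_stable_def
  proof (intro allI impI)
    fix z assume "complex_eigenvalue N z"
    then obtain v where v: "v \<noteq> 0" and Nv: "map_matrix complex_of_real N *v v = z *s v"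
      by (auto simp: complex_eigenvalue_def)
    have "map_matrix complex_of_real M ** map_matrix complex_of_real N =
        map_matrix complex_of_real (M ** N)"
      by (simp add: vec_eq_iff matrix_matrix_mult_def map_matrix_def)
    also have "\<dots> = mat 1" by (simp add: N' vec_eq_iff map_matrix_def mat_def)
    finally have "map_matrix complex_of_real M *v (map_matrix complex_of_real N *v v) = v"
      by (simp add: matrix_vector_mul_assoc)
    then have Mv: "z *s (map_matrix complex_of_real M *v v) = v"
      by (simp add: Nv vector_scalar_commute)
    then have z: "z \<noteq> 0" using v by auto
    have "map_matrix complex_of_real M *v v = inverse z *s v"
      using arg_cong[OF Mv, of "\<lambda>w. inverse z *s w"] z by simp
    then have "complex_eigenvalue M (inverse z)"
      using v by (auto simp: complex_eigenvalue_def)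
    then have "1 < norm (inverse z)" using assms by (auto simp: schur_antistable_def)
    then show "norm z < 1" using z by (simp add: norm_inverse one_less_inverse_iff)
  qed
  then show ?thesis using N' that by blast
qed

section \<open>Quadratic forms\<close>

definition quad_form :: "real^'n^'n \<Rightarrow> real^'n \<Rightarrow> real" where
  "quad_form M x = x \<bullet> (M *v x)"

lemma inner_transpose_matrix_vector:
  fixes M :: "real^'n^'m"
  shows "x \<bullet> (transpose M *v y) = (M *v x) \<bullet> y"
  by (metis dot_lmul_matrix inner_commute transpose_matrix_vector)

lemma symmetric_mat_inner:
  "symmetric_mat M \<Longrightarrow> x \<bullet> (M *v y) = (M *v x) \<bullet> y"
  using inner_transpose_matrix_vector[of x M y] by (simp add: symmetric_mat_def del: transpose_matrix_vector)

lemma symmetric_mat_nth: "symmetric_mat M \<Longrightarrow> M $ i $ j = M $ j $ i"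
  unfolding symmetric_mat_def transpose_def vec_eq_iff by simp

lemma symmetric_mat_add: "symmetric_mat M \<Longrightarrow> symmetric_mat N \<Longrightarrow> symmetric_mat (M + N)"
  by (simp add: symmetric_mat_def transpose_def vec_eq_iff)

lemma symmetric_mat_diff: "symmetric_mat M \<Longrightarrow> symmetric_mat N \<Longrightarrow> symmetric_mat (M - N)"
  by (simp add: symmetric_mat_def transpose_def vec_eq_iff)

lemma symmetric_mat_uminus: "symmetric_mat M \<Longrightarrow> symmetric_mat (- M)"
  by (simp add: symmetric_mat_def transpose_def vec_eq_iff)

lemma transpose_add: "transpose (M + N) = transpose M + transpose N"
  by (simp add: transpose_def vec_eq_iff)

lemma symmetric_mat_congruence:
  fixes M :: "real^'n^'n" and T :: "real^'m^'n"
  shows "symmetric_mat M \<Longrightarrow> symmetric_mat (transpose T ** M ** T)"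
  by (simp add: symmetric_mat_def matrix_transpose_mul matrix_mul_assoc)

lemma quad_form_add_mat: "quad_form (M + N) x = quad_form M x + quad_form N x"
  by (simp add: quad_form_def matrix_vector_mult_add_rdistrib inner_add_right)

lemma quad_form_diff_mat: "quad_form (M - N) x = quad_form M x - quad_form N x"
  by (simp add: quad_form_def matrix_vector_mult_diff_rdistrib inner_diff_right)

lemma quad_form_uminus_mat: "quad_form (- M) x = - quad_form M x"
  using quad_form_diff_mat[of 0 M x] by (simp add: quad_form_def)

lemma quad_form_congruence: "quad_form (transpose T ** M ** T) x = quad_form M (T *v x)"
  unfolding quad_form_def matrix_vector_mul_assoc[symmetric]
  by (simp add: inner_transpose_matrix_vector del: transpose_matrix_vector)

lemma quad_form_0 [simp]: "quad_form M 0 = 0"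
  by (simp add: quad_form_def)

lemma quad_form_vec_add:
  "symmetric_mat M \<Longrightarrow> quad_form M (x + y) = quad_form M x + 2 * (x \<bullet> (M *v y)) + quad_form M y"
  using symmetric_mat_inner[of M x y] by (simp add: quad_form_def matrix_vector_right_distrib inner_add_left inner_add_right inner_commute)

lemma quad_form_scaleR: "quad_form M (c *\<^sub>R x) = c\<^sup>2 * quad_form M x"
  by (simp add: quad_form_def matrix_vector_mult_scaleR power2_eq_square)

lemma continuous_quad_form: "continuous_on UNIV (quad_form M)"
proof -
  have "continuous_on UNIV (\<lambda>x. M *v x)"
    using matrix_vector_mul_linear linear_conv_bounded_linear linear_continuous_on by blast
  then show ?thesis unfolding quad_form_def[abs_def] by (intro continuous_intros)
qed

lemma continuous_quad_form_mat: "continuous_on UNIV (\<lambda>M. quad_form M x)"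
  unfolding quad_form_def[abs_def] matrix_vector_mult_def inner_vec_def
  by (intro continuous_intros)

lemma quad_form_tendsto_0:
  assumes "f \<longlonglongrightarrow> 0"
  shows "(\<lambda>k. quad_form M (f k)) \<longlonglongrightarrow> 0"
  using continuous_on_tendsto_compose[OF continuous_quad_form assms, of M] by simp

lemma abs_quad_form_le: obtains c where "c > 0" "\<And>x. \<bar>quad_form M x\<bar> \<le> c * (norm x)\<^sup>2"
proof -
  obtain c where c: "c > 0" "\<And>x. norm (M *v x) \<le> c * norm x"
    using linear_bounded_pos[OF matrix_vector_mul_linear[of M]] by blast
  have "\<bar>quad_form M x\<bar> \<le> c * (norm x)\<^sup>2" for x
  proof -
    have "\<bar>quad_form M x\<bar> \<le> norm x * norm (M *v x)"
      unfolding quad_form_def by (rule Cauchy_Schwarz_ineq2)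
    also have "\<dots> \<le> norm x * (c * norm x)" by (intro mult_left_mono c) auto
    finally show ?thesis by (simp add: power2_eq_square mult_ac)
  qed
  with c that show ?thesis by blast
qed

text \<open>The constant is the minimum of the form over the compact unit sphere; homogeneity
  extends the bound to all vectors.\<close>

lemma pos_def_lower_bound:
  assumes "pos_def M"
  obtains c where "c > 0" "\<And>x. c * (norm x)\<^sup>2 \<le> quad_form M x"
proof -
  let ?S = "sphere (0::real^'n) 1"
  have "axis undefined 1 \<in> ?S" by (simp add: norm_axis_1)
  then have "?S \<noteq> {}" by blast
  then obtain y where y: "y \<in> ?S" "\<And>x. x \<in> ?S \<Longrightarrow> quad_form M y \<le> quad_form M x"
    using continuous_attains_inf[OF compact_sphere _ continuous_on_subset[OF continuous_quad_form]]
    by (metis subset_UNIV)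
  have "y \<noteq> 0" using y(1) by auto
  then have "quad_form M y > 0" using assms by (simp add: pos_def_def quad_form_def)
  moreover have "quad_form M y * (norm x)\<^sup>2 \<le> quad_form M x" for x
  proof (cases "x = 0")
    case False
    let ?z = "(1 / norm x) *\<^sub>R x"
    have "?z \<in> ?S" using False by simp
    then have "quad_form M y \<le> quad_form M ?z" by (rule y(2))
    also have "\<dots> = quad_form M x / (norm x)\<^sup>2"
      by (simp add: quad_form_scaleR power_divide)
    finally show ?thesis using False by (simp add: pos_le_divide_eq)
  qed simp
  ultimately show ?thesis using that by blast
qed

lemma quad_form_inj:
  assumes "symmetric_mat M" "symmetric_mat N" "\<And>x. quad_form M x = quad_form N x"
  shows "M = N"
proof -
  have "x \<bullet> (M *v y) = x \<bullet> (N *v y)" for x y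
    using quad_form_vec_add[OF assms(1), of x y] quad_form_vec_add[OF assms(2), of x y] assms(3)
    by simp
  then have "M *v y = N *v y" for y
    using vector_eq_rdot[of "M *v y" "N *v y"] by (metis inner_commute)
  then show ?thesis by (simp add: matrix_eq)
qed

lemma matrix_entry_eq_inner: "M $ i $ j = axis i 1 \<bullet> (M *v axis j (1::real))"
  by (simp add: inner_axis' matrix_vector_mult_basis column_def)

lemma inner_symmetric_polarization:
  assumes "symmetric_mat M"
  shows "x \<bullet> (M *v y) = (quad_form M (x + y) - quad_form M x - quad_form M y) / 2"
  using quad_form_vec_add[OF assms, of x y] by simp

text \<open>The diagonal entries are nonnegative with nonpositive sum, so they vanish; testing the
  form on \<open>e_i + e_j\<close> and \<open>e_i - e_j\<close> then kills the remaining entries.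
  This makes the trace strictly monotone in the semidefinite order.\<close>

lemma quad_form_nonneg_trace_zero:
  fixes M :: "real^'n^'n"
  assumes "symmetric_mat M" "\<And>x. 0 \<le> quad_form M x" "trace M \<le> 0"
  shows "M = 0"
proof -
  have diag: "quad_form M (axis i 1) = M $ i $ i" for i
    by (simp add: quad_form_def matrix_entry_eq_inner)
  have diag0: "M $ i $ i = 0" for i
  proof -
    have nn: "0 \<le> M $ i $ i" for i using assms(2)[of "axis i 1"] by (simp add: diag)
    then have "(\<Sum>i\<in>UNIV. M $ i $ i) = 0"
      using assms(3) unfolding trace_def by (intro antisym sum_nonneg) auto
    then have "\<forall>i\<in>UNIV. M $ i $ i = 0"
      by (subst (asm) sum_nonneg_eq_0_iff) (auto simp: nn)
    then show ?thesis by simp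
  qed
  have "M $ i $ j = 0" for i j
  proof -
    have "0 \<le> quad_form M (axis i 1 + axis j 1)" "0 \<le> quad_form M (axis i 1 + (-1) *\<^sub>R axis j 1)"
      using assms(2) by blast+
    then have "0 \<le> 2 * M $ i $ j" "0 \<le> - 2 * M $ i $ j"
      unfolding quad_form_vec_add[OF assms(1)] quad_form_scaleR diag diag0 matrix_vector_mult_scaleR
        inner_scaleR_right matrix_entry_eq_inner[symmetric] by simp_all
    then show ?thesis by linarith
  qed
  then show ?thesis by (simp add: vec_eq_iff)
qed

lemma matrix_mul_matrix_inv:
  assumes "invertible M"
  shows "M ** matrix_inv M = mat 1"
  using someI_ex[OF assms[unfolded invertible_def]] unfolding matrix_inv_def by blast

lemma invertible_quad_form_pos:
  assumes "\<And>x. x \<noteq> 0 \<Longrightarrow> 0 < quad_form M x"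
  shows "invertible M"
proof -
  have "\<forall>x. M *v x = 0 \<longrightarrow> x = 0"
    using assms unfolding quad_form_def by force
  then show ?thesis
    using matrix_left_invertible_ker[of M] invertible_left_inverse by blast
qed

section \<open>Block vectors and block matrices\<close>

lemma sum_UNIV_sum_type:
  fixes f :: "'a::finite + 'b::finite \<Rightarrow> 'c::comm_monoid_add"
  shows "sum f UNIV = (\<Sum>a\<in>UNIV. f (Inl a)) + (\<Sum>b\<in>UNIV. f (Inr b))"
  unfolding UNIV_Plus_UNIV[symmetric] by (simp add: sum.Plus del: UNIV_Plus_UNIV)

lemma inner_block_vec: "block_vec x u \<bullet> block_vec y v = x \<bullet> y + u \<bullet> v"
  by (simp add: inner_vec_def block_vec_def sum_UNIV_sum_type)

lemma norm_block_vec: "(norm (block_vec x u))\<^sup>2 = (norm x)\<^sup>2 + (norm u)\<^sup>2"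
  by (simp add: power2_norm_eq_inner inner_block_vec)

lemma block_mat_mult_block_vec:
  "block_mat M11 M12 M21 M22 *v block_vec x u =
    block_vec (M11 *v x + M12 *v u) (M21 *v x + M22 *v u)"
  by (auto simp: vec_eq_iff block_vec_def block_mat_def matrix_vector_mult_def
      sum_UNIV_sum_type split: sum.split)

lemma quad_form_block_mat:
  "quad_form (block_mat M11 M12 M21 M22) (block_vec x u) =
    quad_form M11 x + x \<bullet> (M12 *v u) + u \<bullet> (M21 *v x) + quad_form M22 u"
  by (simp add: quad_form_def block_mat_mult_block_vec inner_block_vec inner_add_right)

lemma symmetric_block_matD:
  assumes "symmetric_mat (block_mat M11 M12 M21 M22)"
  shows "symmetric_mat M11" "symmetric_mat M22"
proof -
  have "M11 $ i $ j = M11 $ j $ i" for i j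
    using symmetric_mat_nth[OF assms, of "Inl i" "Inl j"] by (simp add: block_mat_def)
  moreover have "M22 $ i $ j = M22 $ j $ i" for i j
    using symmetric_mat_nth[OF assms, of "Inr i" "Inr j"] by (simp add: block_mat_def)
  ultimately show "symmetric_mat M11" "symmetric_mat M22"
    by (auto simp: symmetric_mat_def transpose_def vec_eq_iff)
qed

lemma stage_cost_expand:
  "stage_cost (cost_mat Q S R) x u = quad_form Q x + 2 * (u \<bullet> (S *v x)) + quad_form R u"
  using inner_transpose_matrix_vector[of x S u]
  unfolding stage_cost_def quad_form_def[symmetric] cost_mat_def quad_form_block_mat
  by (simp add: inner_commute)

section \<open>Completion of squares\<close>

text \<open>The right-hand side of the DARE as a map of \<open>P\<close>. When the weight
  \<open>R + transpose B ** P ** B\<close> is positive definite, this is the Bellman operator on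
  quadratic forms, with minimizing input \<open>- (dare_gain A B S R P *v x)\<close>.\<close>

definition riccati_map ::
  "real^'x^'x \<Rightarrow> real^'u^'x \<Rightarrow> real^'x^'x \<Rightarrow> real^'x^'u \<Rightarrow> real^'u^'u \<Rightarrow> real^'x^'x \<Rightarrow> real^'x^'x" where
  "riccati_map A B Q S R P = Q + transpose A ** P ** A
     - (transpose S + transpose A ** P ** B) ** dare_gain A B S R P"

lemma dare_solution_iff_fixpoint:
  "dare_solution A B Q S R P \<longleftrightarrow> symmetric_mat P \<and>
     invertible (R + transpose B ** P ** B) \<and> riccati_map A B Q S R P = P"
  unfolding dare_solution_def riccati_map_def by metis

text \<open>The inverse enters only through the gain. Since the weight is symmetric, transposing the
  first equation rewrites the subtracted term as a congruence, from which symmetry and the completed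
  square can be read off.\<close>

lemma riccati_map_eq:
  fixes A :: "real^'x^'x" and B :: "real^'u^'x" and S :: "real^'x^'u"
  assumes "symmetric_mat R" "symmetric_mat P"
    and inv: "invertible (R + transpose B ** P ** B)"
  defines "K \<equiv> dare_gain A B S R P"
  shows "(R + transpose B ** P ** B) ** K = S + transpose B ** P ** A"
    and "riccati_map A B Q S R P = Q + transpose A ** P ** A
      - transpose K ** (R + transpose B ** P ** B) ** K"
proof -
  let ?M = "R + transpose B ** P ** B"
  show MK: "?M ** K = S + transpose B ** P ** A"
    unfolding K_def dare_gain_def matrix_mul_assoc using matrix_mul_matrix_inv[OF inv] by simp
  have "transpose ?M = ?M"
    using assms symmetric_mat_congruence[of P B] symmetric_mat_add symmetric_mat_def by blast
  then have "transpose K ** ?M = transpose (?M ** K)" by (simp add: matrix_transpose_mul)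
  also have "\<dots> = transpose S + transpose A ** P ** B"
    unfolding MK using assms(2)
    by (simp add: symmetric_mat_def matrix_transpose_mul matrix_mul_assoc transpose_add)
  finally show "riccati_map A B Q S R P = Q + transpose A ** P ** A - transpose K ** ?M ** K"
    unfolding riccati_map_def K_def by simp
qed

lemma symmetric_riccati_map:
  assumes "symmetric_mat Q" "symmetric_mat R" "symmetric_mat P"
    and inv: "invertible (R + transpose B ** P ** B)"
  shows "symmetric_mat (riccati_map A B Q S R P)"
  unfolding riccati_map_eq(2)[OF assms(2-4)] using assms
  by (intro symmetric_mat_add symmetric_mat_diff symmetric_mat_congruence)

lemma completion_of_squares:
  fixes A :: "real^'x^'x" and B :: "real^'u^'x"
  assumes "symmetric_mat R" "symmetric_mat P"
    and inv: "invertible (R + transpose B ** P ** B)"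
  shows "stage_cost (cost_mat Q S R) x u + quad_form P (A *v x + B *v u) =
    quad_form (riccati_map A B Q S R P) x
      + quad_form (R + transpose B ** P ** B) (u + dare_gain A B S R P *v x)"
proof -
  let ?M = "R + transpose B ** P ** B" and ?K = "dare_gain A B S R P"
  have sM: "symmetric_mat ?M"
    using assms by (intro symmetric_mat_add symmetric_mat_congruence)
  \<comment> \<open>The gain is exactly the matrix for which this cross term of the square
    reproduces the mixed terms in \<open>u\<close> and \<open>x\<close>.\<close>
  have "u \<bullet> (?M *v (?K *v x)) = u \<bullet> (S *v x) + u \<bullet> (transpose B *v (P *v (A *v x)))"
    unfolding matrix_vector_mul_assoc riccati_map_eq(1)[OF assms]
    by (simp add: matrix_vector_mult_add_rdistrib inner_add_right matrix_mul_assoc)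
  also have "u \<bullet> (transpose B *v (P *v (A *v x))) = (A *v x) \<bullet> (P *v (B *v u))"
    unfolding inner_transpose_matrix_vector using symmetric_mat_inner[OF assms(2)]
    by (simp add: inner_commute)
  finally have "u \<bullet> (?M *v (?K *v x)) = u \<bullet> (S *v x) + (A *v x) \<bullet> (P *v (B *v u))" .
  moreover have "quad_form ?M u = quad_form R u + quad_form P (B *v u)"
    unfolding quad_form_add_mat quad_form_congruence ..
  moreover have "quad_form (riccati_map A B Q S R P) x =
      quad_form Q x + quad_form P (A *v x) - quad_form ?M (?K *v x)"
    unfolding riccati_map_eq(2)[OF assms]
    by (simp only: quad_form_diff_mat quad_form_add_mat[of Q] quad_form_congruence)
  ultimately show ?thesis
    unfolding stage_cost_expand quad_form_vec_add[OF sM] quad_form_vec_add[OF assms(2)]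
    by linarith
qed

text \<open>Turns the block matrix of the hypothesis into a dissipation inequality with storage
  function \<open>quad_form L\<close>.\<close>

lemma rotated_cost_quad_form:
  assumes "symmetric_mat L"
  shows "quad_form (rotated_cost_mat A B Q S R L) (block_vec x u) =
    stage_cost (cost_mat Q S R) x u + quad_form L x - quad_form L (A *v x + B *v u)"
proof -
  have "x \<bullet> (transpose S *v u) = u \<bullet> (S *v x)"
    unfolding inner_transpose_matrix_vector by (rule inner_commute)
  moreover have "x \<bullet> ((transpose A ** L ** B) *v u) = (A *v x) \<bullet> (L *v (B *v u))"
    by (simp add: matrix_vector_mul_assoc[symmetric] inner_transpose_matrix_vector del: transpose_matrix_vector)
  moreover have "u \<bullet> ((transpose B ** L ** A) *v x) = (A *v x) \<bullet> (L *v (B *v u))"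
    using symmetric_mat_inner[OF assms]
    by (simp add: matrix_vector_mul_assoc[symmetric] inner_transpose_matrix_vector inner_commute del: transpose_matrix_vector)
  ultimately show ?thesis
    unfolding rotated_cost_mat_def quad_form_block_mat stage_cost_expand quad_form_vec_add[OF assms]
      quad_form_add_mat quad_form_diff_mat quad_form_congruence
      matrix_vector_mult_diff_rdistrib inner_diff_right
    by simp
qed

section \<open>Closed-loop trajectories and asymptotic stability\<close>

lemma closed_loop_eq: "closed_loop A B K = (*v) (A - B ** K)"
proof
  fix x
  have "B *v (- (K *v x)) = - (B *v (K *v x))"
    using matrix_vector_mult_scaleR[of B "-1" "K *v x"] by simp
  then show "closed_loop A B K x = (A - B ** K) *v x"
    by (simp add: closed_loop_def matrix_vector_mult_diff_rdistrib matrix_vector_mul_assoc)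
qed

lemma trajectory_feedback:
  "trajectory A B x (feedback_input A B K x) k = ((*v) (A - B ** K) ^^ k) x"
proof -
  let ?f = "closed_loop A B K"
  have "trajectory A B x (feedback_input A B K x) k = (?f ^^ k) x"
    by (induction k) (simp_all add: feedback_input_def closed_loop_def[of A B K "(?f ^^ _) x"])
  then show ?thesis by (simp add: closed_loop_eq)
qed

lemma feedback_input_unique:
  assumes "\<And>k. u k = - (K *v trajectory A B x u k)"
  shows "u = feedback_input A B K x"
proof
  fix k
  have "trajectory A B x u k = (closed_loop A B K ^^ k) x"
  proof (induction k)
    case (Suc k)
    show ?case
      using assms[of k] by (simp add: Suc closed_loop_def[of A B K "(closed_loop A B K ^^ k) x"])
  qed simp
  with assms[of k] show "u k = feedback_input A B K x k" by (simp add: feedback_input_def)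
qed

lemma schur_stable_asymptotically_stable:
  assumes "schur_stable (A - B ** K)"
  shows "asymptotically_stable_equilibrium (closed_loop A B K) 0"
  unfolding asymptotically_stable_equilibrium_def closed_loop_eq
proof (intro conjI allI impI)
  let ?C = "A - B ** K"
  obtain c where c: "c > 0" "\<And>k x. norm (((*v) ?C ^^ k) x) \<le> c * norm x"
    using schur_stable_norm_bound[OF assms] by blast
  fix e :: real assume e: "e > 0"
  have "norm (((*v) ?C ^^ k) x - 0) < e" if "norm (x - 0) < e / c" for x k
  proof -
    have "norm (((*v) ?C ^^ k) x) \<le> c * norm x" by (rule c)
    also have "\<dots> < e" using that c(1) by (simp add: pos_less_divide_eq mult.commute)
    finally show ?thesis by simp
  qed
  then show "\<exists>d>0. \<forall>x. norm (x - 0) < d \<longrightarrow> (\<forall>k. norm (((*v) ?C ^^ k) x - 0) < e)"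
    using e c(1) by (intro exI[of _ "e / c"]) auto
next
  show "\<exists>d>0. \<forall>x. norm (x - 0) < d \<longrightarrow> (\<lambda>k. ((*v) (A - B ** K) ^^ k) x) \<longlonglongrightarrow> 0"
    using schur_stable_tendsto_0[OF assms] by (intro exI[of _ 1]) auto
qed simp

section \<open>Compactness criteria for sets of symmetric matrices\<close>

text \<open>For fixed \<open>x\<close> and \<open>u\<close> every condition is a weak inequality or
  equation between continuous functions of \<open>P\<close>, so the set is an intersection of closed
  sets.\<close>

lemma closed_dissipation_set:
  fixes A :: "real^'x^'x" and B :: "real^'u^'x"
  shows "closed {P. symmetric_mat P \<and> (\<forall>x. 0 \<le> quad_form (P + L) x) \<and>
    (\<forall>x u. quad_form P x \<le> f x u + quad_form P (A *v x + B *v u))}"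
  unfolding quad_form_add_mat symmetric_mat_def vec_eq_iff
  by (intro closed_Collect_conj closed_Collect_all closed_Collect_le closed_Collect_eq
      continuous_intros continuous_quad_form_mat)
    (auto simp: transpose_def intro!: continuous_intros)

text \<open>By polarization an entry \<open>(i, j)\<close> is controlled by the form at
  \<open>e_i\<close>, \<open>e_j\<close> and \<open>e_i + e_j\<close>, so finitely many of the
  pointwise bounds suffice.\<close>

lemma bounded_mat_of_quad_form_bound:
  fixes \<P> :: "(real^'n^'n) set"
  assumes sym: "\<And>P. P \<in> \<P> \<Longrightarrow> symmetric_mat P"
    and bnd: "\<And>x. \<exists>b. \<forall>P\<in>\<P>. \<bar>quad_form P x\<bar> \<le> b"
  shows "bounded \<P>"
proof -
  obtain b where b: "\<And>x P. P \<in> \<P> \<Longrightarrow> \<bar>quad_form P x\<bar> \<le> b x"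
    using bnd by metis
  let ?e = "\<lambda>i::'n. axis i (1::real)"
  let ?c = "\<lambda>i j. (b (?e i + ?e j) + b (?e i) + b (?e j)) / 2"
  have "norm P \<le> (\<Sum>i\<in>UNIV. \<Sum>j\<in>UNIV. ?c i j)" if "P \<in> \<P>" for P
  proof -
    have "\<bar>P $ i $ j\<bar> \<le> ?c i j" for i j
    proof -
      have "\<bar>p - q - r\<bar> / 2 \<le> (p' + q' + r') / 2"
        if "\<bar>p\<bar> \<le> p'" "\<bar>q\<bar> \<le> q'" "\<bar>r\<bar> \<le> r'" for p q r p' q' r' :: real
        using that by (intro divide_right_mono) (auto simp: abs_le_iff)
      then show ?thesis
        unfolding matrix_entry_eq_inner[of P] inner_symmetric_polarization[OF sym[OF that]] abs_divide
        using b[OF that] by simp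
    qed
    then have "norm (P $ i) \<le> (\<Sum>j\<in>UNIV. ?c i j)" for i
      by (intro order_trans[OF norm_le_l1_cart] sum_mono)
    then show ?thesis
      unfolding norm_vec_def[of P]
      by (intro order_trans[OF L2_set_le_sum] sum_mono) auto
  qed
  then show ?thesis unfolding bounded_iff by blast
qed

section \<open>Strictly dissipative linear quadratic problems\<close>

text \<open>Strict pre-dissipativity in quantitative form: a fixed \<open>L\<close> with a uniform
  modulus \<open>e\<close>, stated on states and inputs instead of block matrices.\<close>

locale dissipative_lq =
  fixes A Q L :: "real^'x^'x" and B :: "real^'u^'x" and S :: "real^'x^'u" and R :: "real^'u^'u"
    and e :: real
  assumes symQ: "symmetric_mat Q" and symR: "symmetric_mat R" and symL: "symmetric_mat L"
    and e_pos: "0 < e"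
    and dissipation: "e * ((norm x)\<^sup>2 + (norm u)\<^sup>2) \<le>
      stage_cost (cost_mat Q S R) x u + quad_form L x - quad_form L (A *v x + B *v u)"
begin

abbreviation "cost \<equiv> stage_cost (cost_mat Q S R)"
abbreviation "weight P \<equiv> R + transpose B ** P ** B"
abbreviation "gain \<equiv> dare_gain A B S R"
abbreviation "loop P \<equiv> A - B ** gain P"
abbreviation "traj \<equiv> trajectory A B"

lemma loop_apply: "A *v x + B *v (- (gain P *v x)) = loop P *v x"
  using closed_loop_eq[of A B "gain P"] by (simp add: closed_loop_def fun_eq_iff)

lemma quad_form_weight: "quad_form (weight P) u = cost 0 u + quad_form P (B *v u)"
  by (simp add: quad_form_add_mat quad_form_congruence stage_cost_expand)

text \<open>Dissipation at state 0 bounds \<open>cost 0 u\<close> below by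
  \<open>e * (norm u)\<^sup>2 + quad_form L (B *v u)\<close>, and \<open>P + L\<close> is
  nonnegative at the successor \<open>B *v u\<close>.\<close>

lemma weight_lower_bound:
  assumes "\<And>x. 0 \<le> quad_form (P + L) x"
  shows "e * (norm u)\<^sup>2 \<le> quad_form (weight P) u"
  using dissipation[of 0 u] assms[of "B *v u"]
  by (simp add: quad_form_weight quad_form_add_mat[of P L])

lemma weight_pos:
  assumes "\<And>x. 0 \<le> quad_form (P + L) x" "u \<noteq> 0"
  shows "0 < quad_form (weight P) u"
proof -
  have "0 < e * (norm u)\<^sup>2" using assms(2) e_pos by simp
  then show ?thesis using weight_lower_bound[OF assms(1)] order_less_le_trans by blast
qed

lemma weight_invertible:
  assumes "\<And>x. 0 \<le> quad_form (P + L) x"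
  shows "invertible (weight P)"
  using weight_pos[OF assms] by (rule invertible_quad_form_pos)

section \<open>Telescoped identities along trajectories\<close>

lemma dare_completion:
  assumes "dare_solution A B Q S R P"
  shows "cost x u + quad_form P (A *v x + B *v u) =
    quad_form P x + quad_form (weight P) (u + gain P *v x)"
  using completion_of_squares[OF symR, of P B Q S x u A] assms
  by (simp add: dare_solution_iff_fixpoint)

lemma cost_sum_dare:
  assumes "dare_solution A B Q S R P"
  shows "(\<Sum>k<N. cost (traj x u k) (u k)) + quad_form P (traj x u N) =
    quad_form P x + (\<Sum>k<N. quad_form (weight P) (u k + gain P *v traj x u k))"
proof (induction N)
  case (Suc N)
  then show ?case using dare_completion[OF assms, of "traj x u N" "u N"] by simp
qed simp

lemma cost_sum_dissipation:
  "e * (\<Sum>k<N. (norm (traj x u k))\<^sup>2) \<le>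
    (\<Sum>k<N. cost (traj x u k) (u k)) + quad_form L x - quad_form L (traj x u N)"
proof (induction N)
  case (Suc N)
  have "e * (norm (traj x u N))\<^sup>2 \<le> e * ((norm (traj x u N))\<^sup>2 + (norm (u N))\<^sup>2)"
    using e_pos by simp
  then show ?case
    using Suc dissipation[of "traj x u N" "u N"] by (simp add: distrib_left)
qed simp

text \<open>Under the feedback of \<open>P\<close> all squares in \<open>cost_sum_dare\<close>
  vanish. Comparing with the telescoped dissipation inequality shows that \<open>P + L\<close> is a
  Lyapunov function for the loop, without regard to its sign.\<close>

lemma storage_sum:
  assumes "dare_solution A B Q S R P"
  shows "e * (\<Sum>k<N. (norm (((*v) (loop P) ^^ k) x))\<^sup>2) \<le>
    quad_form (P + L) x - quad_form (P + L) (((*v) (loop P) ^^ N) x)"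
proof -
  let ?u = "feedback_input A B (gain P) x"
  have u: "?u k + gain P *v traj x ?u k = 0" for k
    by (simp add: feedback_input_def trajectory_feedback closed_loop_eq)
  show ?thesis
    using cost_sum_dare[OF assms, where x=x and u="?u" and N=N] cost_sum_dissipation[where x=x and u="?u" and N=N]
    unfolding u unfolding trajectory_feedback quad_form_add_mat by simp
qed

section \<open>Stability of the loop and uniqueness of the stabilizing solution\<close>

text \<open>A nonnegative storage can only decrease by a finite total amount, so the squared norms
  along every orbit are summable.\<close>

lemma loop_stable:
  assumes "dare_solution A B Q S R P" and nn: "\<And>x. 0 \<le> quad_form (P + L) x"
  shows "schur_stable (loop P)"
proof (rule schur_stableI_tendsto_0)
  fix x
  let ?y = "\<lambda>k. ((*v) (loop P) ^^ k) x"
  have "e * (\<Sum>k<N. (norm (?y k))\<^sup>2) \<le> quad_form (P + L) x" for N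
    using storage_sum[OF assms(1), where N=N and x=x] nn[of "?y N"] by linarith
  then have "(\<Sum>k<N. (norm (?y k))\<^sup>2) \<le> quad_form (P + L) x / e" for N
    using e_pos by (simp add: pos_le_divide_eq mult.commute)
  then have "(\<Sum>k\<le>N. (norm (?y k))\<^sup>2) \<le> quad_form (P + L) x / e" for N
    by (metis lessThan_Suc_atMost)
  then have "summable (\<lambda>k. (norm (?y k))\<^sup>2)"
    by (intro bounded_imp_summable) auto
  then have "(\<lambda>k. (norm (?y k))\<^sup>2) \<longlonglongrightarrow> 0" by (rule summable_LIMSEQ_zero)
  then show "?y \<longlonglongrightarrow> 0"
    by (simp add: tendsto_norm_zero_iff)
qed

text \<open>\<open>P + L\<close> at the start of an orbit is at least its value at every later time,
  and these values tend to 0 because the orbit does.\<close>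

lemma stabilizing_storage_nonneg:
  assumes "stabilizing_solution A B Q S R P"
  shows "0 \<le> quad_form (P + L) x"
proof -
  let ?y = "\<lambda>k. ((*v) (loop P) ^^ k) x"
  have P: "dare_solution A B Q S R P" "schur_stable (loop P)"
    using assms by (auto simp: stabilizing_solution_def)
  have "quad_form (P + L) (?y N) \<le> quad_form (P + L) x" for N
  proof -
    have "0 \<le> e * (\<Sum>k<N. (norm (?y k))\<^sup>2)"
      using e_pos by (intro mult_nonneg_nonneg sum_nonneg) auto
    then show ?thesis using storage_sum[OF P(1), where N=N and x=x] by linarith
  qed
  moreover have "(\<lambda>N. quad_form (P + L) (?y N)) \<longlonglongrightarrow> 0"
    by (intro quad_form_tendsto_0 schur_stable_tendsto_0 P)
  ultimately show ?thesis by (intro LIMSEQ_le_const2) auto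
qed

text \<open>The feedback of \<open>P'\<close> serves as a trial input for \<open>P\<close>: it
  realizes \<open>quad_form P' x\<close>, while the identity for \<open>P\<close> adds nonnegative
  squares to \<open>quad_form P x\<close>. The terminal terms vanish in the limit. Exchanging the
  roles gives uniqueness.\<close>

lemma stabilizing_le:
  assumes P: "stabilizing_solution A B Q S R P" and P': "stabilizing_solution A B Q S R P'"
  shows "quad_form P x \<le> quad_form P' x"
proof -
  let ?u = "feedback_input A B (gain P') x" and ?y = "\<lambda>k. ((*v) (loop P') ^^ k) x"
  have dP: "dare_solution A B Q S R P" and dP': "dare_solution A B Q S R P'"
    and stab: "schur_stable (loop P')"
    using assms by (auto simp: stabilizing_solution_def)
  have u: "?u k + gain P' *v traj x ?u k = 0" for k
    by (simp add: feedback_input_def trajectory_feedback closed_loop_eq)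
  have "quad_form P x + quad_form P' (?y N) - quad_form P (?y N) \<le> quad_form P' x" for N
  proof -
    have "0 \<le> quad_form (weight P) v" for v
      using weight_lower_bound[OF stabilizing_storage_nonneg[OF P], of v] e_pos
      by (meson less_imp_le mult_nonneg_nonneg order_trans zero_le_power2)
    then have "0 \<le> (\<Sum>k<N. quad_form (weight P) (?u k + gain P *v traj x ?u k))"
      by (intro sum_nonneg)
    then show ?thesis
      using cost_sum_dare[OF dP, where x=x and u="?u" and N=N] cost_sum_dare[OF dP', of x ?u N]
      unfolding u unfolding trajectory_feedback by simp
  qed
  moreover have "(\<lambda>N. quad_form P x + quad_form P' (?y N) - quad_form P (?y N))
      \<longlonglongrightarrow> quad_form P x + 0 - 0"
    by (intro tendsto_intros quad_form_tendsto_0 schur_stable_tendsto_0 stab)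
  ultimately show ?thesis by (intro LIMSEQ_le_const2) auto
qed

lemma stabilizing_unique:
  assumes "stabilizing_solution A B Q S R P" "stabilizing_solution A B Q S R P'"
  shows "P = P'"
proof (rule quad_form_inj)
  show "symmetric_mat P" "symmetric_mat P'"
    using assms by (auto simp: stabilizing_solution_def dare_solution_def)
  show "quad_form P x = quad_form P' x" for x
    using stabilizing_le[OF assms] stabilizing_le[OF assms(2,1)] by (intro antisym)
qed

section \<open>Existence of the stabilizing solution\<close>

text \<open>The constraint \<open>P + L \<ge> 0\<close> makes the weight \<open>R + B\<^sup>T P B\<close> positive definite.\<close>

definition subsolutions :: "(real^'x^'x) set" where
  "subsolutions = {P. symmetric_mat P \<and> (\<forall>x. 0 \<le> quad_form (P + L) x) \<and>
     (\<forall>x u. quad_form P x \<le> cost x u + quad_form P (A *v x + B *v u))}"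

text \<open>Provides the element that makes the later maximization nonvacuous; it is the least
  subsolution.\<close>

lemma uminus_L_subsolution: "- L \<in> subsolutions"
proof -
  have "0 \<le> e * ((norm x)\<^sup>2 + (norm u)\<^sup>2)" for x :: "real^'x" and u :: "real^'u"
    using e_pos by simp
  then have "- quad_form L x \<le> cost x u - quad_form L (A *v x + B *v u)" for x u
    using dissipation[of x u] by (smt (verit))
  then show ?thesis
    by (simp add: subsolutions_def symmetric_mat_uminus[OF symL] quad_form_uminus_mat)
      (simp add: quad_form_def)
qed

lemma subsolution_le_cost_sum:
  assumes "P \<in> subsolutions"
  shows "quad_form P x \<le> (\<Sum>k<N. cost (traj x u k) (u k)) + quad_form P (traj x u N)"
proof (induction N)
  case (Suc N)
  have "quad_form P (traj x u N) \<le> cost (traj x u N) (u N) + quad_form P (traj x u (Suc N))"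
    using assms by (simp add: subsolutions_def)
  with Suc show ?case by simp
qed simp

text \<open>A stabilizing feedback has a finite total cost, and a subsolution lies below cost plus
  terminal value along its trajectory, where the terminal value tends to 0.\<close>

lemma subsolutions_bounded_above:
  assumes "stabilizable A B"
  shows "\<exists>b. \<forall>P\<in>subsolutions. quad_form P x \<le> b"
proof -
  obtain K where K: "schur_stable (A - B ** K)" using assms by (auto simp: stabilizable_def)
  let ?u = "feedback_input A B K x" and ?y = "\<lambda>k. ((*v) (A - B ** K) ^^ k) x"
  have u: "?u k = - (K *v ?y k)" for k by (simp add: feedback_input_def closed_loop_eq)
  obtain c where c: "c > 0" "\<And>z. \<bar>quad_form (cost_mat Q S R) z\<bar> \<le> c * (norm z)\<^sup>2"
    using abs_quad_form_le[of "cost_mat Q S R"] by blast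
  obtain d where d: "d > 0" "\<And>z. norm (K *v z) \<le> d * norm z"
    using linear_bounded_pos[OF matrix_vector_mul_linear[of K]] by blast
  obtain g where g: "g > 0" "\<And>k. norm (?y k) \<le> g * norm x"
    using schur_stable_norm_bound[OF K] by metis
  \<comment> \<open>One of the two factors \<open>norm (?y k)\<close> of the quadratic cost is
    replaced by its uniform bound \<open>g * norm x\<close>, so that summability of the norms is
    enough.\<close>
  let ?m = "c * (1 + d\<^sup>2) * (g * norm x)"
  have m: "0 \<le> ?m" using c g by simp
  have cost_le: "cost (?y k) (?u k) \<le> ?m * norm (?y k)" for k
  proof -
    have "cost (?y k) (?u k) \<le> c * ((norm (?y k))\<^sup>2 + (norm (?u k))\<^sup>2)"
      using c(2)[of "block_vec (?y k) (?u k)"]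
      by (simp add: stage_cost_def quad_form_def norm_block_vec)
    also have "(norm (?u k))\<^sup>2 \<le> (d * norm (?y k))\<^sup>2"
      unfolding u norm_minus_cancel by (intro power_mono d) auto
    also have "c * ((norm (?y k))\<^sup>2 + (d * norm (?y k))\<^sup>2) =
        c * (1 + d\<^sup>2) * norm (?y k) * norm (?y k)"
      by (simp add: algebra_simps power2_eq_square)
    also have "\<dots> \<le> c * (1 + d\<^sup>2) * (g * norm x) * norm (?y k)"
      using c(1) by (intro mult_right_mono mult_left_mono g) auto
    finally show ?thesis using c(1) by simp
  qed
  let ?b = "?m * (\<Sum>k. norm (?y k))"
  have sum_le: "(\<Sum>k<N. cost (?y k) (?u k)) \<le> ?b" for N
  proof -
    have "(\<Sum>k<N. cost (?y k) (?u k)) \<le> ?m * (\<Sum>k<N. norm (?y k))"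
      unfolding sum_distrib_left by (intro sum_mono cost_le)
    also have "\<dots> \<le> ?b"
      by (intro mult_left_mono sum_le_suminf m schur_stable_summable_norm K) auto
    finally show ?thesis .
  qed
  have "quad_form P x \<le> ?b" if "P \<in> subsolutions" for P
  proof -
    have "quad_form P x \<le> ?b + quad_form P (?y N)" for N
      using subsolution_le_cost_sum[OF that, where x=x and N=N and u="?u"] sum_le[of N]
      unfolding trajectory_feedback by linarith
    moreover have "(\<lambda>N. ?b + quad_form P (?y N)) \<longlonglongrightarrow> ?b + 0"
      by (intro tendsto_intros quad_form_tendsto_0 schur_stable_tendsto_0 K)
    ultimately show ?thesis by (intro LIMSEQ_le_const[of _ ?b]) auto
  qed
  then show ?thesis by blast
qed

lemma compact_subsolutions:
  assumes "stabilizable A B"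
  shows "compact subsolutions"
  unfolding compact_eq_bounded_closed
proof
  show "closed subsolutions"
    unfolding subsolutions_def by (rule closed_dissipation_set)
  show "bounded subsolutions"
  proof (rule bounded_mat_of_quad_form_bound)
    show "symmetric_mat P" if "P \<in> subsolutions" for P
      using that by (simp add: subsolutions_def)
    fix x
    obtain b where b: "\<And>P. P \<in> subsolutions \<Longrightarrow> quad_form P x \<le> b"
      using subsolutions_bounded_above[OF assms] by blast
    have "- quad_form L x \<le> quad_form P x" if "P \<in> subsolutions" for P
    proof -
      have "0 \<le> quad_form (P + L) x" using that by (simp add: subsolutions_def)
      then show ?thesis by (simp add: quad_form_add_mat)
    qed
    then have "\<bar>quad_form P x\<bar> \<le> max b (quad_form L x)" if "P \<in> subsolutions" for P
      using b[OF that] that by fastforce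
    then show "\<exists>b. \<forall>P\<in>subsolutions. \<bar>quad_form P x\<bar> \<le> b" by blast
  qed
qed

text \<open>Inserting the minimizing input into the Bellman inequality gives the second claim. For
  any input the image then lies below cost plus \<open>P\<close> at the successor, and raising
  \<open>P\<close> to its image there keeps the inequality.\<close>

lemma riccati_map_subsolution:
  assumes "P \<in> subsolutions"
  shows "riccati_map A B Q S R P \<in> subsolutions"
    and "quad_form P x \<le> quad_form (riccati_map A B Q S R P) x"
proof -
  let ?F = "riccati_map A B Q S R P"
  have sym: "symmetric_mat P" and nn: "\<And>x. 0 \<le> quad_form (P + L) x"
    and sub: "\<And>x u. quad_form P x \<le> cost x u + quad_form P (A *v x + B *v u)"
    using assms by (auto simp: subsolutions_def)
  note inv = weight_invertible[OF nn]
  note compl = completion_of_squares[OF symR sym inv, of Q S _ _ A]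
  show le: "quad_form P x \<le> quad_form ?F x" for x
    using sub[of x "- (gain P *v x)"] compl[of x "- (gain P *v x)"] by simp
  have "quad_form ?F x \<le> cost x u + quad_form ?F (A *v x + B *v u)" for x u
  proof -
    have "0 \<le> quad_form (weight P) (u + gain P *v x)"
      using weight_pos[OF nn] by (cases "u + gain P *v x = 0") (auto intro: less_imp_le)
    then show ?thesis using compl[of x u] le[of "A *v x + B *v u"] by linarith
  qed
  moreover have "0 \<le> quad_form (?F + L) x" for x
    using nn[of x] le[of x] by (simp add: quad_form_add_mat)
  ultimately show "?F \<in> subsolutions"
    using symmetric_riccati_map[OF symQ symR sym inv] by (simp add: subsolutions_def)
qed

lemma stabilizing_exists:
  assumes "stabilizable A B"
  shows "\<exists>P. stabilizing_solution A B Q S R P"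
proof -
  have "continuous_on subsolutions trace"
    unfolding trace_def[abs_def] by (intro continuous_intros)
  then obtain P where P: "P \<in> subsolutions" "\<And>P'. P' \<in> subsolutions \<Longrightarrow> trace P' \<le> trace P"
    using continuous_attains_sup[OF compact_subsolutions[OF assms], of trace]
      uminus_L_subsolution by blast
  let ?F = "riccati_map A B Q S R P"
  note F = riccati_map_subsolution[OF P(1)]
  \<comment> \<open>The difference is positive semidefinite, and maximality makes its trace
    nonpositive. Hence the maximizer is a fixed point, and \<open>loop_stable\<close> supplies its
    stability.\<close>
  have "?F - P = 0"
  proof (rule quad_form_nonneg_trace_zero)
    show "symmetric_mat (?F - P)"
      using F(1) P(1) by (intro symmetric_mat_diff) (auto simp: subsolutions_def)
    show "0 \<le> quad_form (?F - P) x" for x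
      using F(2)[of x] by (simp add: quad_form_diff_mat)
    show "trace (?F - P) \<le> 0"
      using P(2)[OF F(1)] by (simp add: trace_sub)
  qed
  then have fp: "?F = P" by simp
  have nn: "\<And>x. 0 \<le> quad_form (P + L) x" and "symmetric_mat P"
    using P(1) by (auto simp: subsolutions_def)
  then have "dare_solution A B Q S R P"
    using fp weight_invertible[OF nn] by (simp add: dare_solution_iff_fixpoint)
  then show ?thesis
    using loop_stable[OF _ nn] by (auto simp: stabilizing_solution_def)
qed

section \<open>Consequences of the antistabilizing solution\<close>

text \<open>Along the loop \<open>P + L\<close> decreases; run backwards, the loop contracts to \<open>0\<close>.\<close>

lemma antistabilizing_storage_nonpos:
  assumes "dare_solution A B Q S R P" "loop P ** N = mat 1" "schur_stable N"
  shows "quad_form (P + L) x \<le> 0"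
proof -
  let ?y = "\<lambda>k. ((*v) N ^^ k) x"
  have step: "quad_form (P + L) y \<le> quad_form (P + L) (N *v y)" for y
  proof -
    have "loop P *v (N *v y) = y" using assms(2) by (simp add: matrix_vector_mul_assoc)
    moreover have "0 \<le> e * (norm (N *v y))\<^sup>2" using e_pos by simp
    ultimately show ?thesis
      using storage_sum[OF assms(1), where N=1 and x="N *v y"] by simp
  qed
  have "quad_form (P + L) x \<le> quad_form (P + L) (?y k)" for k
    by (induction k) (auto intro: order_trans step)
  moreover have "(\<lambda>k. quad_form (P + L) (?y k)) \<longlonglongrightarrow> 0"
    by (intro quad_form_tendsto_0 schur_stable_tendsto_0 assms)
  ultimately show ?thesis by (intro LIMSEQ_le_const) auto
qed

text \<open>The loop is invertible, so for each \<open>v\<close> some state is driven to 0 by the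
  feedback input plus \<open>v\<close>. For that step dissipation gives
  \<open>cost x u + quad_form L x \<ge> 0\<close>, and \<open>cost x u\<close> is
  \<open>quad_form P x\<close> plus the weight at \<open>v\<close>; since \<open>P + L\<close> is
  nonpositive, the weight must be nonnegative.\<close>

lemma antistabilizing_weight_nonneg:
  assumes "antistabilizing_solution A B Q S R P"
  shows "0 \<le> quad_form (weight P) v"
proof -
  have P: "dare_solution A B Q S R P" "schur_antistable (loop P)"
    using assms by (auto simp: antistabilizing_solution_def)
  obtain N where N: "loop P ** N = mat 1" "schur_stable N"
    using schur_antistable_inverse[OF P(2)] by blast
  \<comment> \<open>the state that \<open>v\<close> steers to \<open>0\<close> in one step\<close>
  define x where "x = - (N *v (B *v v))"
  define u where "u = v - gain P *v x"
  have "A *v x + B *v u = loop P *v x + B *v v"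
    unfolding u_def loop_apply[symmetric]
    using matrix_vector_mult_scaleR[of B "-1" "gain P *v x"]
    by (simp add: matrix_vector_mult_diff_distrib)
  also have "loop P *v x = - (B *v v)"
    unfolding x_def using matrix_vector_mult_scaleR[of "loop P" "-1" "N *v (B *v v)"] N(1)
    by (simp add: matrix_vector_mul_assoc[of "loop P"])
  finally have 0: "A *v x + B *v u = 0" by simp
  have "0 \<le> e * ((norm x)\<^sup>2 + (norm u)\<^sup>2)" using e_pos by simp
  moreover have "cost x u = quad_form P x + quad_form (weight P) v"
    using dare_completion[OF P(1), of x u] 0 by (simp add: u_def)
  ultimately show ?thesis
    using dissipation[of x u] antistabilizing_storage_nonpos[OF P(1) N, of x] 0
    by (simp add: quad_form_add_mat[of P L])
qed

section \<open>Lower bound on the cost and the optimal input\<close>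

lemma finite_cost_dare:
  assumes "dare_solution A B Q S R P"
  shows "finite_cost A B (cost_mat Q S R) Pf x u N = quad_form P x
    + (\<Sum>k<N. quad_form (weight P) (u k + gain P *v traj x u k)) + quad_form (Pf - P) (traj x u N)"
  using cost_sum_dare[OF assms, where x=x and u=u and N=N]
  by (simp add: finite_cost_def quad_form_def[symmetric] quad_form_diff_mat)

lemma finite_cost_imp_tendsto_0:
  assumes Pa: "antistabilizing_solution A B Q S R Pa" and E: "pos_def E"
    and J: "has_cost A B (cost_mat Q S R) (Pa + E) x u J" "J < \<infinity>"
  shows "traj x u \<longlonglongrightarrow> 0"
proof -
  let ?J = "finite_cost A B (cost_mat Q S R) (Pa + E) x u"
  have dPa: "dare_solution A B Q S R Pa" using Pa by (simp add: antistabilizing_solution_def)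
  \<comment> \<open>\<open>J\<close> may still be minus infinity here, so a real number above it is
    used as the bound.\<close>
  obtain c where c: "J < ereal c" using J(2) less_PInf_Ex_of_nat ereal_dense2 by blast
  have "\<forall>\<^sub>F N in sequentially. ereal (?J N) < ereal c"
    using J(1)[unfolded has_cost_def] c by (rule order_tendstoD)
  then obtain N0 where N0: "\<And>N. N \<ge> N0 \<Longrightarrow> ?J N < c"
    by (auto simp: eventually_sequentially)
  obtain a where a: "a > 0" "\<And>x. a * (norm x)\<^sup>2 \<le> quad_form E x"
    using pos_def_lower_bound[OF E] by blast
  \<comment> \<open>This terminal form has no known sign in the dissipation sum, but it is bounded
    along the trajectory once the states are.\<close>
  obtain b where b: "b > 0" "\<And>x. \<bar>quad_form (Pa + E + L) x\<bar> \<le> b * (norm x)\<^sup>2"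
    using abs_quad_form_le[of "Pa + E + L"] by blast
  let ?y = "traj x u"
  define m where "m = (c - quad_form Pa x) / a"
  have ybound: "(norm (?y N))\<^sup>2 \<le> m" if "N \<ge> N0" for N
  proof -
    have "0 \<le> (\<Sum>k<N. quad_form (weight Pa) (u k + gain Pa *v ?y k))"
      by (intro sum_nonneg antistabilizing_weight_nonneg[OF Pa])
    then have "quad_form Pa x + quad_form E (?y N) \<le> c"
      using N0[OF that] finite_cost_dare[OF dPa, where Pf="Pa + E" and x=x and u=u and N=N] by simp
    then show ?thesis
      using a(1) a(2)[of "?y N"] by (simp add: m_def pos_le_divide_eq mult.commute)
  qed
  have sumbound: "(\<Sum>k<N. (norm (?y k))\<^sup>2) \<le> (c + quad_form L x + b * m) / e"
    if "N \<ge> N0" for N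
  proof -
    have "b * (norm (?y N))\<^sup>2 \<le> b * m" using ybound[OF that] b(1) by simp
    moreover have "e * (\<Sum>k<N. (norm (?y k))\<^sup>2) \<le>
        ?J N + quad_form L x - quad_form (Pa + E + L) (?y N)"
      using cost_sum_dissipation[where x=x and u=u and N=N]
      by (simp add: finite_cost_def quad_form_def[symmetric] quad_form_add_mat)
    ultimately have "e * (\<Sum>k<N. (norm (?y k))\<^sup>2) \<le> c + quad_form L x + b * m"
      using N0[OF that] b(2)[of "?y N"] by linarith
    then show ?thesis using e_pos by (simp add: pos_le_divide_eq mult.commute)
  qed
  have "(\<Sum>k\<le>N. (norm (?y k))\<^sup>2) \<le> (c + quad_form L x + b * m) / e" for N
    \<comment> \<open>The bound does not depend on the horizon, so any partial sum may be extended
      past \<open>N0\<close>; \<open>Suc N\<close> accounts for the passage from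
      \<open>{..N}\<close> to a strict upper limit.\<close>
    by (rule order_trans[OF sum_mono2 sumbound[of "max N0 (Suc N)"]]) auto
  then have "summable (\<lambda>k. (norm (?y k))\<^sup>2)"
    by (intro bounded_imp_summable) auto
  then have "(\<lambda>k. (norm (?y k))\<^sup>2) \<longlonglongrightarrow> 0" by (rule summable_LIMSEQ_zero)
  then show ?thesis by (simp add: tendsto_norm_zero_iff)
qed

text \<open>Keeping the first \<open>n\<close> squares serves two purposes: \<open>n = 0\<close>
  bounds the value, and larger \<open>n\<close> rules out every other optimal input.\<close>

lemma cost_lower_bound:
  assumes Ps: "stabilizing_solution A B Q S R Ps"
    and Pa: "antistabilizing_solution A B Q S R Pa" and E: "pos_def E"
    and J: "has_cost A B (cost_mat Q S R) (Pa + E) x u J"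
  shows "ereal (quad_form Ps x + (\<Sum>k<n. quad_form (weight Ps) (u k + gain Ps *v traj x u k))) \<le> J"
proof (cases "J = \<infinity>")
  case False
  let ?w = "\<lambda>k. quad_form (weight Ps) (u k + gain Ps *v traj x u k)"
  let ?J = "finite_cost A B (cost_mat Q S R) (Pa + E) x u"
  \<comment> \<open>The finite cost with all but the first \<open>n\<close> squares dropped. Its
    terminal term vanishes in the limit because a cost below \<open>\<infinity>\<close> forces the
    state to 0.\<close>
  let ?lo = "\<lambda>N. quad_form Ps x + (\<Sum>k<n. ?w k) + quad_form (Pa + E - Ps) (traj x u N)"
  have dPs: "dare_solution A B Q S R Ps" using Ps by (simp add: stabilizing_solution_def)
  have w: "0 \<le> ?w k" for k
    using weight_pos[OF stabilizing_storage_nonneg[OF Ps]]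
    by (cases "u k + gain Ps *v traj x u k = 0") (auto intro: less_imp_le)
  have "traj x u \<longlonglongrightarrow> 0" using finite_cost_imp_tendsto_0[OF Pa E J] False by simp
  then have "?lo \<longlonglongrightarrow> quad_form Ps x + (\<Sum>k<n. ?w k) + 0"
    by (intro tendsto_intros quad_form_tendsto_0)
  then have lo: "(\<lambda>N. ereal (?lo N)) \<longlonglongrightarrow> ereal (quad_form Ps x + (\<Sum>k<n. ?w k))"
    by (intro tendsto_ereal) simp
  have "?lo N \<le> ?J N" if "N \<ge> n" for N
  proof -
    have "(\<Sum>k<n. ?w k) \<le> (\<Sum>k<N. ?w k)" using that w by (intro sum_mono2) auto
    then show ?thesis using finite_cost_dare[OF dPs, where Pf="Pa + E" and x=x and u=u and N=N] by simp
  qed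
  then show ?thesis
    by (intro LIMSEQ_le[OF lo J[unfolded has_cost_def]]) auto
qed simp

text \<open>All squares vanish under this feedback, and the state decays, so the terminal term
  contributes nothing in the limit.\<close>

lemma feedback_cost:
  assumes Ps: "stabilizing_solution A B Q S R Ps"
  shows "has_cost A B (cost_mat Q S R) Pf x (feedback_input A B (gain Ps) x) (ereal (quad_form Ps x))"
proof -
  let ?u = "feedback_input A B (gain Ps) x" and ?y = "\<lambda>k. ((*v) (loop Ps) ^^ k) x"
  have dPs: "dare_solution A B Q S R Ps" and stab: "schur_stable (loop Ps)"
    using Ps by (auto simp: stabilizing_solution_def)
  have u: "?u k + gain Ps *v traj x ?u k = 0" for k
    by (simp add: feedback_input_def trajectory_feedback closed_loop_eq)
  have "finite_cost A B (cost_mat Q S R) Pf x ?u N = quad_form Ps x + quad_form (Pf - Ps) (?y N)" for N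
    unfolding finite_cost_dare[OF dPs] u by (simp add: trajectory_feedback)
  moreover have "(\<lambda>N. quad_form Ps x + quad_form (Pf - Ps) (?y N)) \<longlonglongrightarrow> quad_form Ps x + 0"
    by (intro tendsto_intros quad_form_tendsto_0 schur_stable_tendsto_0 stab)
  ultimately show ?thesis by (simp add: has_cost_def)
qed

theorem value_function_eq:
  assumes Ps: "stabilizing_solution A B Q S R Ps"
    and Pa: "antistabilizing_solution A B Q S R Pa" and E: "pos_def E"
  shows "value_function A B (cost_mat Q S R) (Pa + E) x = ereal (quad_form Ps x)"
  unfolding value_function_def
proof (rule Inf_eqI)
  show "ereal (quad_form Ps x) \<le> J" if "J \<in> {J. \<exists>u. has_cost A B (cost_mat Q S R) (Pa + E) x u J}" for J
    using that cost_lower_bound[OF Ps Pa E, where x=x and J=J and n=0] by auto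
qed (use feedback_cost[OF Ps] in blast)

theorem optimal_input_iff:
  assumes Ps: "stabilizing_solution A B Q S R Ps"
    and Pa: "antistabilizing_solution A B Q S R Pa" and E: "pos_def E"
  shows "optimal_input A B (cost_mat Q S R) (Pa + E) x u \<longleftrightarrow> u = feedback_input A B (gain Ps) x"
  unfolding optimal_input_def value_function_eq[OF assms]
proof
  let ?w = "\<lambda>k. quad_form (weight Ps) (u k + gain Ps *v traj x u k)"
  assume J: "has_cost A B (cost_mat Q S R) (Pa + E) x u (ereal (quad_form Ps x))"
  note pos = weight_pos[OF stabilizing_storage_nonneg[OF Ps]]
  have w: "0 \<le> ?w k" for k
    using pos by (cases "u k + gain Ps *v traj x u k = 0") (auto intro: less_imp_le)
  have "u k + gain Ps *v traj x u k = 0" for k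
  \<comment> \<open>One nonzero deviation adds a positive square, which already pushes the cost
    above the value; \<open>n = Suc k\<close> is the first bound that includes index
    \<open>k\<close>.\<close>
  proof (rule ccontr)
    assume "u k + gain Ps *v traj x u k \<noteq> 0"
    then have "0 < ?w k" by (rule pos)
    also have "?w k \<le> (\<Sum>k<Suc k. ?w k)" using w by (intro member_le_sum) auto
    finally show False
      using cost_lower_bound[OF Ps Pa E J, where n="Suc k"] by simp
  qed
  then show "u = feedback_input A B (gain Ps) x"
    by (intro feedback_input_unique) (simp add: eq_neg_iff_add_eq_0)
qed (simp add: feedback_cost[OF Ps])

end

text \<open>Positive definiteness of the rotated matrix yields the uniform modulus \<open>e\<close>
  through its minimum on the unit sphere.\<close>

lemma strictly_pre_dissipative_locale:
  assumes "symmetric_mat (cost_mat Q S R)" "strictly_pre_dissipative A B Q S R"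
  obtains L e where "dissipative_lq A Q L B S R e"
proof -
  obtain L where L: "symmetric_mat L" "pos_def (rotated_cost_mat A B Q S R L)"
    using assms(2) by (auto simp: strictly_pre_dissipative_def)
  obtain e where e: "e > 0" "\<And>z. e * (norm z)\<^sup>2 \<le> quad_form (rotated_cost_mat A B Q S R L) z"
    using pos_def_lower_bound[OF L(2)] by blast
  have "dissipative_lq A Q L B S R e"
  proof
    show "symmetric_mat Q" "symmetric_mat R"
      using symmetric_block_matD assms(1) unfolding cost_mat_def by blast+
    show "e * ((norm x)\<^sup>2 + (norm u)\<^sup>2) \<le> stage_cost (cost_mat Q S R) x u
        + quad_form L x - quad_form L (A *v x + B *v u)" for x u
      using e(2)[of "block_vec x u"] unfolding norm_block_vec rotated_cost_quad_form[OF L(1)] .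
  qed (use L e in auto)
  then show ?thesis using that by blast
qed

theorem mainTheorem3:
  fixes A Q Pa E :: "real^'x^'x"
    and B :: "real^'u^'x"
    and S :: "real^'x^'u"
    and R :: "real^'u^'u"
  assumes "symmetric_mat (cost_mat Q S R)"
    and "strictly_pre_dissipative A B Q S R"
    and "stabilizable A B"
    and "antistabilizing_solution A B Q S R Pa"
    and "symmetric_mat E"
    and "pos_def E"
  shows "(\<exists>!Ps. stabilizing_solution A B Q S R Ps) \<and>
    (\<forall>Ps. stabilizing_solution A B Q S R Ps \<longrightarrow>
       (\<forall>x. value_function A B (cost_mat Q S R) (Pa + E) x = ereal (x \<bullet> (Ps *v x))) \<and>
       (\<forall>x u. optimal_input A B (cost_mat Q S R) (Pa + E) x u \<longleftrightarrow>
              u = feedback_input A B (dare_gain A B S R Ps) x) \<and>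
       asymptotically_stable_equilibrium (closed_loop A B (dare_gain A B S R Ps)) 0)"
proof -
  obtain L e where "dissipative_lq A Q L B S R e"
    using strictly_pre_dissipative_locale[OF assms(1,2)] by blast
  then interpret dissipative_lq A Q L B S R e .
  have "\<exists>!Ps. stabilizing_solution A B Q S R Ps"
    using stabilizing_exists[OF assms(3)] stabilizing_unique by blast
  moreover have "schur_stable (A - B ** gain Ps)" if "stabilizing_solution A B Q S R Ps" for Ps
    using that by (simp add: stabilizing_solution_def)
  ultimately show ?thesis
    using value_function_eq[OF _ assms(4,6), unfolded quad_form_def]
      optimal_input_iff[OF _ assms(4,6)]
    by (auto intro!: schur_stable_asymptotically_stable)
qed

end
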